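(* Let $\gamma = \mathcal{O}(1)$ be a positive constant. Any static pointer-based data structure (pointer machine) that stores a set $S$ of $n$ points in the plane and answers dominating minima reporting queries in $\mathcal{O}(\log^\gamma n + t)$ time, where $t$ is the size of the answer, must use $\Omega\!\left(n\frac{\log n}{\log\log n}\right)$ space (in the worst case over input sets of $n$ points). *)

theory Defs
  imports Complex_Main
begin

type_synonym point = "real \<times> real"

definition dominates :: "point \<Rightarrow> point \<Rightarrow> bool" where
  "dominates p q \<longleftrightarrow> fst q \<le> fst p \<and> snd q \<le> snd p"

definition minima :: "point set \<Rightarrow> point set" where
  "minima P = {p \<in> P. \<not> (\<exists>p'\<in>P. p' \<noteq> p \<and> dominates p p')}"

definition dominating_minima :: "point set \<Rightarrow> point \<Rightarrow> point set" where
  "dominating_minima S q = minima {p \<in> S. dominates p q}"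

text \<open>
  The pointer machine of Tarjan in the form used by Chazelle for reporting lower bounds.
  Memory consists of records with a fixed number \<open>d\<close> of fields, each of which is empty or holds
  a pointer to a record or an input point; points are atomic, so a point can only be reported
  from a field that holds it.  Records are reached only by following pointers from the entry record.
  Every instruction costs one time unit.  As usual in this model, the computation that selects
  the next instruction is free: a query algorithm is an arbitrary function from query
  points to instruction sequences.  Hence auxiliary non-point data in the records need not be
  represented, and every record visited so far may be addressed.
\<close>

datatype cell = Null | Ptr nat | Pt point

datatype instr =
    Follow nat nat          \<comment> \<open>visit the record that field \<open>i\<close> of \<open>v\<close> points to\<close>
  | Alloc nat               \<comment> \<open>create a new, empty record\<close>
  | Link nat nat nat        \<comment> \<open>make field \<open>i\<close> of \<open>v\<close> point to \<open>u\<close>\<close>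
  | Copy nat nat nat nat    \<comment> \<open>overwrite field \<open>i\<close> of \<open>v\<close> by field \<open>j\<close> of \<open>u\<close>\<close>
  | Report nat nat          \<comment> \<open>output the point in field \<open>i\<close> of \<open>v\<close>\<close>

record pm_structure =
  nodes :: "nat set"
  entry :: nat
  cell_at :: "nat \<Rightarrow> nat \<Rightarrow> cell"
  query_alg :: "point \<Rightarrow> instr list"

record config =
  alive :: "nat set"
  visited :: "nat set"
  mem :: "nat \<Rightarrow> nat \<Rightarrow> cell"
  reported :: "point set"

fun exec :: "nat \<Rightarrow> instr \<Rightarrow> config \<Rightarrow> config option" where
  "exec d (Follow v i) c =
     (if v \<in> visited c \<and> i < d
      then (case mem c v i of Ptr w \<Rightarrow> Some (c\<lparr>visited := insert w (visited c)\<rparr>) | _ \<Rightarrow> None)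
      else None)"
| "exec d (Alloc v) c =
     (if v \<notin> alive c
      then Some (c\<lparr>alive := insert v (alive c), visited := insert v (visited c),
                   mem := (mem c)(v := (\<lambda>_. Null))\<rparr>)
      else None)"
| "exec d (Link v i u) c =
     (if v \<in> visited c \<and> i < d \<and> u \<in> visited c
      then Some (c\<lparr>mem := (mem c)(v := (mem c v)(i := Ptr u))\<rparr>)
      else None)"
| "exec d (Copy v i u j) c =
     (if v \<in> visited c \<and> i < d \<and> u \<in> visited c \<and> j < d
      then Some (c\<lparr>mem := (mem c)(v := (mem c v)(i := mem c u j))\<rparr>)
      else None)"
| "exec d (Report v i) c =
     (if v \<in> visited c \<and> i < d
      then (case mem c v i of Pt p \<Rightarrow> Some (c\<lparr>reported := insert p (reported c)\<rparr>) | _ \<Rightarrow> None)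
      else None)"

fun run :: "nat \<Rightarrow> instr list \<Rightarrow> config \<Rightarrow> config option" where
  "run d [] c = Some c"
| "run d (a # as) c = Option.bind (exec d a c) (run d as)"

text \<open>The structure is static: every query starts from the stored records.\<close>

definition init :: "pm_structure \<Rightarrow> config" where
  "init G = \<lparr>alive = nodes G, visited = {entry G}, mem = cell_at G, reported = {}\<rparr>"

definition well_formed :: "nat \<Rightarrow> pm_structure \<Rightarrow> bool" where
  "well_formed d G \<longleftrightarrow> finite (nodes G) \<and> entry G \<in> nodes G \<and>
     (\<forall>v\<in>nodes G. \<forall>i<d. \<forall>w. cell_at G v i = Ptr w \<longrightarrow> w \<in> nodes G)"

definition answers_dominating_minima :: "nat \<Rightarrow> pm_structure \<Rightarrow> point set \<Rightarrow> bool" where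
  "answers_dominating_minima d G S \<longleftrightarrow>
     (\<forall>q. \<exists>c. run d (query_alg G q) (init G) = Some c \<and> reported c = dominating_minima S q)"

definition query_time :: "pm_structure \<Rightarrow> point \<Rightarrow> nat" where
  "query_time G q = length (query_alg G q)"

definition pm_space :: "pm_structure \<Rightarrow> nat" where
  "pm_space G = card (nodes G)"

end

theory Submission
  imports Defs "HOL-Library.FuncSet" "HOL-Real_Asymp.Real_Asymp"
begin

text \<open>
  Take a point set whose answers are large and meet pairwise in at most one point. The stored
  records visited by a query form a tree below the entry record; as its size is linear in the
  answer, a constant fraction of the reported points can be charged to pairs of points that both lie
  within constant distance \<open>k\<close> below a common record. A pair determines its query, and a record
  has only constantly many such pairs below it, so the space is at least a constant times the sum
  of all answer sizes.

  The point set consists of the points \<open>(x, -rev x)\<close>, where \<open>x\<close> has \<open>m\<close> digits in base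
  \<open>b \<ge> log\<^sup>\<gamma> n\<close>, \<open>b\<^sup>m = \<Theta>(n)\<close>, and \<open>rev\<close> reverses the digits. The points that differ in a single
  fixed digit form an antichain whose bounding box contains no other point, and the query at the
  lower left corner of this box reports exactly these points. There are \<open>m b\<^sup>m\<^sup>-\<^sup>1\<close> such groups of
  \<open>b\<close> points, with \<open>m = \<Theta>(log n / log log n)\<close>.
\<close>

section \<open>Pointer machines\<close>

text \<open>Edges come from \<open>cell_at G\<close>, the contents before the query, so pointers
  written during a run create no shortcuts.\<close>

inductive visit_tree :: "nat \<Rightarrow> pm_structure \<Rightarrow> nat set \<Rightarrow> bool" for d G where
  root: "visit_tree d G {entry G}"
| step: "visit_tree d G W \<Longrightarrow> u \<in> W \<Longrightarrow> i < d \<Longrightarrow> cell_at G u i = Ptr w \<Longrightarrow> visit_tree d G (insert w W)"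

text \<open>A record entering \<open>W\<close> gets as parent the record holding the pointer to it;
  records already in \<open>W\<close> keep theirs. With the entry record as its own parent,
  \<open>par\<close> can be iterated any number of times inside \<open>W\<close>.\<close>

lemma visit_tree_parents:
  assumes "visit_tree d G W"
  shows "\<exists>par dep. par (entry G) = entry G \<and> dep (entry G) = (0::nat) \<and>
    (\<forall>v\<in>W. par v \<in> W \<and>
      (v = entry G \<or> dep v = Suc (dep (par v)) \<and> (\<exists>i<d. cell_at G (par v) i = Ptr v)))"
  using assms
proof induction
  case root
  show ?case
    by (rule exI[of _ id], rule exI[of _ "\<lambda>_. 0"]) simp
next
  case (step W u i w)
  then obtain par dep where pd: "par (entry G) = entry G" "dep (entry G) = (0::nat)"
    "\<And>v. v \<in> W \<Longrightarrow> par v \<in> W"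
    "\<And>v. v \<in> W \<Longrightarrow> v = entry G \<or> dep v = Suc (dep (par v)) \<and> (\<exists>i<d. cell_at G (par v) i = Ptr v)"
    by blast
  have eW: "entry G \<in> W"
    using step.hyps(1) by induction auto
  show ?case
  proof (cases "w \<in> W")
    case True
    then have "insert w W = W" by blast
    then show ?thesis using pd by (intro exI[of _ par] exI[of _ dep]) auto
  next
    case False
    show ?thesis
    proof (rule exI[of _ "par(w := u)"], rule exI[of _ "dep(w := Suc (dep u))"], intro conjI ballI)
      show "(par(w := u)) (entry G) = entry G" "(dep(w := Suc (dep u))) (entry G) = 0"
        using eW False pd by auto
    next
      fix v assume "v \<in> insert w W"
      then show "(par(w := u)) v \<in> insert w W" using pd(3) step.hyps by auto
    next
      fix v assume v: "v \<in> insert w W"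
      show "v = entry G \<or>
         (dep(w := Suc (dep u))) v = Suc ((dep(w := Suc (dep u))) ((par(w := u)) v)) \<and>
         (\<exists>i<d. cell_at G ((par(w := u)) v) i = Ptr v)"
      proof (cases "v = w")
        case True
        have "u \<noteq> w" using False step.hyps by auto
        then show ?thesis using True step.hyps by auto
      next
        case vw: False
        then have "v \<in> W" using v by auto
        \<comment> \<open>No older record has the new \<open>w\<close> as parent, so changing
          \<open>dep\<close> at \<open>w\<close> leaves its depth equation intact.\<close>
        then have "par v \<noteq> w" using pd(3) False by auto
        then show ?thesis using vw pd(4)[OF \<open>v \<in> W\<close>] by auto
      qed
    qed
  qed
qed

section \<open>The invariant of a query run\<close>

definition stored :: "nat \<Rightarrow> pm_structure \<Rightarrow> nat set \<Rightarrow> cell set" where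
  "stored d G W = {cell_at G u i | u i. u \<in> W \<and> i < d}"

lemma stored_mono: "W \<subseteq> W' \<Longrightarrow> stored d G W \<subseteq> stored d G W'"
  by (auto simp: stored_def)

text \<open>Writes only move contents that are already available: besides \<open>Null\<close> and
  pointers to visited records, visited records hold only original contents of records in
  \<open>W\<close>. Hence \<open>W\<close> accounts for every reported point. The condition on
  \<open>alive\<close> keeps new records apart from stored ones.\<close>

definition query_inv :: "nat \<Rightarrow> pm_structure \<Rightarrow> nat set \<Rightarrow> config \<Rightarrow> bool" where
  "query_inv d G W c \<longleftrightarrow> visit_tree d G W \<and> W = visited c \<inter> nodes G \<and> nodes G \<subseteq> alive c \<and>
     (\<forall>v\<in>visited c. \<forall>i<d. mem c v i \<in> {Null} \<union> Ptr ` visited c \<union> stored d G W) \<and>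
     (\<forall>v\<in>nodes G - visited c. mem c v = cell_at G v) \<and> Pt ` reported c \<subseteq> stored d G W"

text \<open>Only following a pointer to an unvisited record enlarges \<open>W\<close>: allocated
  records lie outside \<open>nodes G\<close>, and the other instructions visit nothing new.\<close>

lemma query_inv_exec:
  assumes wf: "well_formed d G" and inv: "query_inv d G W c" and ex: "exec d a c = Some c'"
  shows "\<exists>W'. query_inv d G W' c' \<and> finite W' = finite W \<and> card W' \<le> Suc (card W)"
proof -
  have tree: "visit_tree d G W" and W: "W = visited c \<inter> nodes G" and alive: "nodes G \<subseteq> alive c"
    and vis: "\<And>v i. v \<in> visited c \<Longrightarrow> i < d \<Longrightarrow> mem c v i \<in> {Null} \<union> Ptr ` visited c \<union> stored d G W"
    and unvis: "\<And>v. v \<in> nodes G \<Longrightarrow> v \<notin> visited c \<Longrightarrow> mem c v = cell_at G v"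
    and rep: "Pt ` reported c \<subseteq> stored d G W"
    using inv unfolding query_inv_def by blast+
  have same: ?thesis if "query_inv d G W c'"
    using that by (intro exI[of _ W]) simp
  show ?thesis
  proof (cases a)
    case (Follow v i)
    then obtain w where w: "v \<in> visited c" "i < d" "mem c v i = Ptr w"
      and c': "c' = c\<lparr>visited := insert w (visited c)\<rparr>"
      using ex by (auto split: if_splits cell.splits)
    show ?thesis
    proof (cases "w \<in> visited c")
      case True
      then have "c' = c" using c' by (simp add: insert_absorb)
      then show ?thesis using inv same by simp
    next
      case False
      \<comment> \<open>A pointer to an unvisited record is an original one, possibly copied into
        \<open>v\<close>. The tree edge therefore starts at an original owner \<open>u\<close>,
        which may differ from \<open>v\<close>.\<close>
      have "Ptr w \<in> stored d G W" using vis[OF w(1,2)] w(3) False by auto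
      then obtain u j where u: "u \<in> W" "j < d" "cell_at G u j = Ptr w"
        unfolding stored_def by force
      have wn: "w \<in> nodes G"
        using wf u W unfolding well_formed_def by blast
      have mono: "stored d G W \<subseteq> stored d G (insert w W)"
        by (rule stored_mono) blast
      have "query_inv d G (insert w W) c'"
        unfolding query_inv_def
      proof (intro conjI ballI allI impI)
        show "visit_tree d G (insert w W)" using tree u by (rule visit_tree.step)
        show "insert w W = visited c' \<inter> nodes G" unfolding W c' using wn by simp
        show "nodes G \<subseteq> alive c'" using alive c' by simp
        show "Pt ` reported c' \<subseteq> stored d G (insert w W)" using rep mono c' by simp
      next
        fix x l assume x: "x \<in> visited c'" "l < d"
        show "mem c' x l \<in> {Null} \<union> Ptr ` visited c' \<union> stored d G (insert w W)"
        proof (cases "x = w")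
          case True
          \<comment> \<open>A stored record is unmodified when first visited, so all its cells are
            original.\<close>
          have "cell_at G w l \<in> stored d G (insert w W)" using x(2) unfolding stored_def by blast
          then show ?thesis using unvis[OF wn False] True c' by simp
        next
          case False
          then show ?thesis using vis[of x l] x mono unfolding c' by auto
        qed
      next
        fix x assume "x \<in> nodes G - visited c'"
        then show "mem c' x = cell_at G x" using unvis c' by simp
      qed
      moreover have "card (insert w W) \<le> Suc (card W)" by (cases "finite W") (auto simp: card_insert_if)
      ultimately show ?thesis by (intro exI[of _ "insert w W"]) simp
    qed
  next
    case (Alloc v)
    then have v: "v \<notin> alive c" and c': "c' = c\<lparr>alive := insert v (alive c),
        visited := insert v (visited c), mem := (mem c)(v := (\<lambda>_. Null))\<rparr>"
      using ex by (auto split: if_splits)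
    have "v \<notin> nodes G" using v alive by blast
    then have "W = visited c' \<inter> nodes G" unfolding W c' by simp
    then show ?thesis
      using tree alive vis unvis rep by (intro same) (auto simp: query_inv_def c')
  next
    case (Link v i u)
    then have "v \<in> visited c" "u \<in> visited c"
      and c': "c' = c\<lparr>mem := (mem c)(v := (mem c v)(i := Ptr u))\<rparr>"
      using ex by (auto split: if_splits)
    moreover have "W = visited c' \<inter> nodes G" unfolding W c' by simp
    ultimately show ?thesis
      using tree alive vis unvis rep by (intro same) (auto simp: query_inv_def)
  next
    case (Copy v i u j)
    then have "v \<in> visited c" "u \<in> visited c" "j < d"
      and c': "c' = c\<lparr>mem := (mem c)(v := (mem c v)(i := mem c u j))\<rparr>"
      using ex by (auto split: if_splits)
    moreover have "W = visited c' \<inter> nodes G" unfolding W c' by simp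
    ultimately show ?thesis
      using tree alive vis unvis rep by (intro same) (auto simp: query_inv_def)
  next
    case (Report v i)
    then obtain p where p: "v \<in> visited c" "i < d" "mem c v i = Pt p"
      and c': "c' = c\<lparr>reported := insert p (reported c)\<rparr>"
      using ex by (auto split: if_splits cell.splits)
    have "Pt p \<in> stored d G W" using vis[OF p(1,2)] p(3) by auto
    moreover have "W = visited c' \<inter> nodes G" unfolding W c' by simp
    ultimately show ?thesis
      using tree alive vis unvis rep by (intro same) (auto simp: query_inv_def c')
  qed
qed

lemma query_inv_run:
  assumes "well_formed d G" "query_inv d G W c" "run d as c = Some c'" "finite W"
  shows "\<exists>W'. query_inv d G W' c' \<and> finite W' \<and> card W' \<le> card W + length as"
  using assms(2-)
proof (induction as arbitrary: c W)
  case Nil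
  then show ?case by auto
next
  case (Cons a as)
  then obtain c1 where c1: "exec d a c = Some c1" "run d as c1 = Some c'"
    by (auto simp: bind_eq_Some_conv)
  obtain W1 where W1: "query_inv d G W1 c1" "finite W1" "card W1 \<le> Suc (card W)"
    using query_inv_exec[OF assms(1) Cons.prems(1) c1(1)] Cons.prems(3) by auto
  from Cons.IH[OF W1(1) c1(2) W1(2)] W1(3) show ?case by fastforce
qed

text \<open>The invariant starts with \<open>W = {entry G}\<close>, which accounts for the
  \<open>Suc\<close>; each instruction adds at most one record.\<close>

lemma visited_tree_of_run:
  assumes "well_formed d G" "run d as (init G) = Some c"
  obtains W where "visit_tree d G W" "W \<subseteq> nodes G" "finite W" "card W \<le> Suc (length as)"
    "Pt ` reported c \<subseteq> stored d G W"
proof -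
  have "query_inv d G {entry G} (init G)"
    using assms(1) visit_tree.root
    by (auto simp: query_inv_def init_def well_formed_def stored_def)
  from query_inv_run[OF assms(1) this assms(2)] that show thesis
    unfolding query_inv_def by auto
qed

section \<open>Points near a record and close pairs\<close>

fun reach :: "nat \<Rightarrow> pm_structure \<Rightarrow> nat \<Rightarrow> nat \<Rightarrow> nat set" where
  "reach d G 0 z = {z}"
| "reach d G (Suc k) z = reach d G k z \<union> {w. Ptr w \<in> stored d G (reach d G k z)}"

definition near :: "nat \<Rightarrow> pm_structure \<Rightarrow> nat \<Rightarrow> nat \<Rightarrow> point set" where
  "near d G k z = {p. Pt p \<in> stored d G (reach d G k z)}"

lemma stored_bound:
  assumes "finite W"
  shows "finite (stored d G W)" "card (stored d G W) \<le> card W * d"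
proof -
  have eq: "stored d G W = (\<lambda>(u, i). cell_at G u i) ` (W \<times> {..<d})"
    by (auto simp: stored_def)
  show "finite (stored d G W)" unfolding eq using assms by simp
  show "card (stored d G W) \<le> card W * d"
    unfolding eq using card_image_le[of "W \<times> {..<d}"] assms by (simp add: card_cartesian_product)
qed

lemma reach_bound: "finite (reach d G k z) \<and> card (reach d G k z) \<le> (d + 1) ^ k"
proof (induction k)
  case (Suc k)
  let ?R = "reach d G k z" and ?N = "{w. Ptr w \<in> stored d G (reach d G k z)}"
  have f: "finite (stored d G ?R)" and c: "card (stored d G ?R) \<le> card ?R * d"
    using stored_bound Suc by auto
  have N: "Ptr ` ?N \<subseteq> stored d G ?R" by auto
  have inj: "inj_on Ptr ?N" by (auto simp: inj_on_def)
  have fN: "finite ?N" using finite_subset[OF N f] inj finite_imageD by blast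
  have "card ?N \<le> card ?R * d"
    using card_mono[OF f N] c by (simp add: card_image[OF inj])
  then have "card (?R \<union> ?N) \<le> card ?R * (d + 1)"
    using card_Un_le[of ?R ?N] by simp
  also have "\<dots> \<le> (d + 1) ^ k * (d + 1)" using Suc by (intro mult_right_mono) auto
  finally show ?case using fN Suc by (simp add: mult.commute)
qed simp

lemma near_bound: "finite (near d G k z) \<and> card (near d G k z) \<le> (d + 1) ^ Suc k"
proof -
  let ?R = "reach d G k z"
  have R: "finite ?R" "card ?R \<le> (d + 1) ^ k" using reach_bound by auto
  have N: "Pt ` near d G k z \<subseteq> stored d G ?R" by (auto simp: near_def)
  have inj: "inj_on Pt (near d G k z)" by (auto simp: inj_on_def)
  have "card (near d G k z) \<le> card ?R * d"
    using card_mono[OF stored_bound(1)[OF R(1)] N] stored_bound(2)[OF R(1), of d G] by (simp add: card_image[OF inj])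
  also have "\<dots> \<le> (d + 1) ^ k * (d + 1)" using R(2) by (intro mult_mono) auto
  finally show ?thesis
    using finite_subset[OF N stored_bound(1)[OF R(1)]] inj finite_imageD by (auto simp: mult.commute)
qed

definition close_pairs :: "nat \<Rightarrow> pm_structure \<Rightarrow> nat \<Rightarrow> point set set" where
  "close_pairs d G k = {e. card e = 2 \<and> (\<exists>z\<in>nodes G. e \<subseteq> near d G k z)}"

text \<open>Every close pair is a subset of some \<open>near\<close> set. Counting all subsets is
  crude, but the factor depends only on \<open>d\<close> and \<open>k\<close>.\<close>

lemma card_close_pairs:
  assumes "finite (nodes G)"
  shows "finite (close_pairs d G k)" "card (close_pairs d G k) \<le> card (nodes G) * 2 ^ ((d + 1) ^ Suc k)"
proof -
  let ?U = "\<Union>z\<in>nodes G. Pow (near d G k z)"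
  have sub: "close_pairs d G k \<subseteq> ?U" by (auto simp: close_pairs_def)
  have fin: "finite ?U" using assms near_bound by auto
  show "finite (close_pairs d G k)" using finite_subset[OF sub fin] .
  have "card (close_pairs d G k) \<le> card ?U" using card_mono[OF fin sub] .
  also have "\<dots> \<le> (\<Sum>z\<in>nodes G. card (Pow (near d G k z)))" using assms by (rule card_UN_le)
  also have "\<dots> \<le> (\<Sum>z\<in>nodes G. 2 ^ ((d + 1) ^ Suc k))"
    using near_bound by (intro sum_mono) (simp only: card_Pow, intro power_increasing, auto)
  finally show "card (close_pairs d G k) \<le> card (nodes G) * 2 ^ ((d + 1) ^ Suc k)" by simp
qed

section \<open>Close pairs within one answer\<close>

lemma large_independent_set:
  assumes "finite E" "\<And>e. e \<in> E \<Longrightarrow> e \<noteq> {}"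
  obtains I where "I \<subseteq> V" "card V - card E \<le> card I" "\<And>e. e \<in> E \<Longrightarrow> \<not> e \<subseteq> I"
proof -
  let ?f = "\<lambda>e. SOME x. x \<in> e"
  have f: "?f e \<in> e" if "e \<in> E" for e using assms(2)[OF that] some_in_eq by blast
  show thesis
  \<comment> \<open>One chosen element of each edge is deleted.\<close>
  proof (rule that[of "V - ?f ` E"])
    show "card V - card E \<le> card (V - ?f ` E)"
      using diff_card_le_card_Diff[of "?f ` E" V] card_image_le[OF assms(1), of ?f] assms(1) by fastforce
  qed (use f in auto)
qed

text \<open>Delete one point from each close pair. From a record holding a remaining point, walk up
  \<open>k\<close> parents: two such paths cannot share a record, since both points would be near
  it. The disjoint paths fit into the visited tree, whose size is bounded by the time. The
  \<open>- 1\<close> allows for one point whose record has depth below \<open>k\<close>.\<close>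

lemma reported_close_pairs:
  fixes k :: nat
  assumes wf: "well_formed d G" and run: "run d as (init G) = Some c" and fin: "finite (reported c)"
  defines "E \<equiv> {e \<in> close_pairs d G k. e \<subseteq> reported c}"
  shows "Suc k * (card (reported c) - card E - 1) \<le> Suc (length as)"
proof -
  obtain W where W: "visit_tree d G W" "W \<subseteq> nodes G" "finite W" "card W \<le> Suc (length as)"
    "Pt ` reported c \<subseteq> stored d G W"
    using visited_tree_of_run[OF wf run] .
  obtain par and dep :: "nat \<Rightarrow> nat" where pd: "par (entry G) = entry G" "dep (entry G) = 0"
    "\<And>v. v \<in> W \<Longrightarrow> par v \<in> W"
    "\<And>v. v \<in> W \<Longrightarrow> v = entry G \<or> dep v = Suc (dep (par v)) \<and> (\<exists>i<d. cell_at G (par v) i = Ptr v)"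
    using visit_tree_parents[OF W(1)] by blast
  have parW: "(par ^^ j) v \<in> W" if "v \<in> W" for j v
    using that pd(3) by (induction j) auto
  \<comment> \<open>Each parent step reverses a stored pointer. At the entry record
    \<open>par\<close> stands still, which is harmless because \<open>reach\<close> is
    cumulative.\<close>
  have "v \<in> reach d G j ((par ^^ j) v)" if "v \<in> W" for j v
    using that
  proof (induction j arbitrary: v)
    case (Suc j)
    have IH: "par v \<in> reach d G j ((par ^^ j) (par v))" using Suc pd(3) by blast
    show ?case
    proof (cases "v = entry G")
      case True
      then show ?thesis using IH pd(1) by (simp add: funpow_swap1)
    next
      case False
      then obtain i where "i < d" "cell_at G (par v) i = Ptr v" using pd(4)[OF Suc.prems] by auto
      then have "Ptr v \<in> stored d G (reach d G j ((par ^^ j) (par v)))"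
        using IH unfolding stored_def by force
      then show ?thesis by (simp add: funpow_swap1)
    qed
  qed simp
  moreover have "reach d G j z \<subseteq> reach d G k z" if "j \<le> k" for j z
    using that by (rule lift_Suc_mono_le[of "\<lambda>j. reach d G j z", rotated]) auto
  ultimately have anc: "v \<in> reach d G k ((par ^^ j) v)" if "v \<in> W" "j \<le> k" for j v
    using that by blast
  \<comment> \<open>Truncated subtraction fits here: the entry record has depth 0 and is its own
    parent.\<close>
  have depth: "dep ((par ^^ j) v) = dep v - j" if "v \<in> W" for j v
  proof (induction j)
    case (Suc j)
    have "dep (par u) = dep u - 1" if "u \<in> W" for u
      using pd(1,2) pd(4)[OF that] by auto
    then show ?case using Suc parW[OF \<open>v \<in> W\<close>] by simp
  qed simp
  have dep0: "v = entry G" if "v \<in> W" "dep v = 0" for v using pd(4)[OF that(1)] that(2) by auto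

  have "finite E" unfolding E_def by (rule finite_subset[of _ "Pow (reported c)"]) (use fin in auto)
  moreover have "e \<noteq> {}" if "e \<in> E" for e using that by (auto simp: E_def close_pairs_def)
  ultimately obtain I where I: "I \<subseteq> reported c" "card (reported c) - card E \<le> card I"
    "\<And>e. e \<in> E \<Longrightarrow> \<not> e \<subseteq> I"
    using large_independent_set by blast
  have finI: "finite I" using I(1) fin finite_subset by blast
  have "\<exists>w. w \<in> W \<and> Pt p \<in> stored d G {w}" if "p \<in> I" for p
  proof -
    have "Pt p \<in> stored d G W" using that I(1) W(5) by auto
    then show ?thesis unfolding stored_def by blast
  qed
  then obtain w where w: "\<And>p. p \<in> I \<Longrightarrow> w p \<in> W" "\<And>p. p \<in> I \<Longrightarrow> Pt p \<in> stored d G {w p}"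
    by metis
  \<comment> \<open>The record \<open>w p\<close> holding \<open>p\<close>, with its first
    \<open>k\<close> ancestors.\<close>
  define A where "A p = (\<lambda>j. (par ^^ j) (w p)) ` {..k}" for p
  have AW: "A p \<subseteq> W" if "p \<in> I" for p using parW w(1)[OF that] by (auto simp: A_def)
  have Anear: "p \<in> near d G k z" if "p \<in> I" "z \<in> A p" for p z
  proof -
    obtain j where "j \<le> k" "z = (par ^^ j) (w p)" using \<open>z \<in> A p\<close> by (auto simp: A_def)
    then have "w p \<in> reach d G k z" using anc[OF w(1)[OF \<open>p \<in> I\<close>]] by simp
    then have "stored d G {w p} \<subseteq> stored d G (reach d G k z)" by (intro stored_mono) auto
    then show ?thesis using w(2)[OF \<open>p \<in> I\<close>] unfolding near_def by blast
  qed
  have disj: "A p \<inter> A q = {}" if "p \<in> I" "q \<in> I" "p \<noteq> q" for p q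
  proof (rule ccontr)
    assume "A p \<inter> A q \<noteq> {}"
    then obtain z where z: "z \<in> A p" "z \<in> A q" by blast
    then have "{p, q} \<subseteq> near d G k z" "z \<in> nodes G"
      using Anear that AW W(2) by blast+
    then have "{p, q} \<in> E" using that I(1) by (auto simp: E_def close_pairs_def)
    then show False using I(3) that by blast
  qed
  \<comment> \<open>A short ancestor path ends in the entry record, so at most one point has one.\<close>
  define J where "J = {p \<in> I. k \<le> dep (w p)}"
  have finJ: "finite J" using finI by (simp add: J_def)
  have cardA: "card (A p) = Suc k" if "p \<in> J" for p
  proof -
    \<comment> \<open>With \<open>k \<le> dep (w p)\<close>, the ancestors have pairwise distinct
      depths \<open>dep (w p) - j\<close>.\<close>
    have "inj_on (\<lambda>j. (par ^^ j) (w p)) {..k}"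
    proof (rule inj_onI)
      fix i j assume "i \<in> {..k}" "j \<in> {..k}" "(par ^^ i) (w p) = (par ^^ j) (w p)"
      then have "dep (w p) - i = dep (w p) - j" "i \<le> k" "j \<le> k"
        using depth[of "w p"] w(1) that by (auto simp: J_def) metis
      then show "i = j" using that by (auto simp: J_def)
    qed
    then show ?thesis unfolding A_def by (simp add: card_image)
  qed
  have root: "entry G \<in> A p" if "p \<in> I - J" for p
  proof -
    have "dep ((par ^^ k) (w p)) = 0" using depth w(1) that by (auto simp: J_def)
    then have "(par ^^ k) (w p) = entry G" using dep0 parW w(1) that by auto
    then show ?thesis unfolding A_def by (metis atMost_iff image_eqI order_refl)
  qed
  have "p = q" if "p \<in> I - J" "q \<in> I - J" for p q
    using root[OF that(1)] root[OF that(2)] disj[of p q] that by blast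
  then have "card (I - J) \<le> Suc 0" using finI by (subst card_le_Suc0_iff_eq) auto
  moreover have "card (I - J) = card I - card J"
    using finJ by (rule card_Diff_subset) (auto simp: J_def)
  ultimately have "card (reported c) - card E - 1 \<le> card J" using I(2) by linarith
  then have "Suc k * (card (reported c) - card E - 1) \<le> card J * Suc k"
    by (metis mult.commute mult_le_mono1)
  also have "\<dots> = (\<Sum>p\<in>J. card (A p))" using cardA by simp
  also have "\<dots> = card (\<Union>p\<in>J. A p)"
    using finJ disj by (intro card_UN_disjoint[symmetric]) (auto simp: J_def A_def)
  also have "\<dots> \<le> card W" using AW W(3) by (intro card_mono) (auto simp: J_def)
  finally show ?thesis using W(4) by simp
qed

text \<open>The time bound forces every answer to contain at least \<open>b / 2\<close> close pairs.
  No pair lies in two answers, so these add up to at most the number of all close pairs. Queries are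
  named by an arbitrary index type, so that combinatorial data can serve as index.\<close>

lemma pointer_machine_space_bound:
  fixes A :: "'q \<Rightarrow> point set"
  assumes wf: "well_formed d G" and finQ: "finite Q"
    and run: "\<And>q. q \<in> Q \<Longrightarrow> \<exists>as c. run d as (init G) = Some c \<and> reported c = A q \<and>
      Suc (length as) * 4 \<le> Suc k * b"
    and card: "\<And>q. q \<in> Q \<Longrightarrow> card (A q) = b" and b: "4 \<le> b"
    and meet: "\<And>q r e. q \<in> Q \<Longrightarrow> r \<in> Q \<Longrightarrow> q \<noteq> r \<Longrightarrow> e \<subseteq> A q \<Longrightarrow> e \<subseteq> A r \<Longrightarrow> card e \<noteq> 2"
  shows "card Q * b \<le> 2 * (card (nodes G) * 2 ^ ((d + 1) ^ Suc k))"
proof -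
  define E where "E q = {e \<in> close_pairs d G k. e \<subseteq> A q}" for q
  have finG: "finite (nodes G)" using wf by (simp add: well_formed_def)
  note cp = card_close_pairs[OF finG, of d k]
  have E: "b \<le> 2 * card (E q)" if q: "q \<in> Q" for q
  proof -
    obtain as c where c: "run d as (init G) = Some c" "reported c = A q"
      "Suc (length as) * 4 \<le> Suc k * b"
      using run[OF q] by blast
    have "finite (A q)" by (rule card_ge_0_finite) (use card[OF q] b in simp)
    then have "Suc k * (b - card (E q) - 1) \<le> Suc (length as)"
      using reported_close_pairs[OF wf c(1), of k] c(2) card[OF q] by (simp add: E_def)
    from mult_le_mono1[OF this, of 4] c(3)
    have "Suc k * ((b - card (E q) - 1) * 4) \<le> Suc k * b"
      unfolding mult.assoc[symmetric] by linarith
    then have "(b - card (E q) - 1) * 4 \<le> b" by (subst (asm) Suc_mult_le_cancel1)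
    \<comment> \<open>This gives \<open>card (E q) \<ge> 3 * b / 4 - 1\<close>, which is at least
      \<open>b / 2\<close> because \<open>4 \<le> b\<close>.\<close>
    then show ?thesis using b by linarith
  qed
  have "card Q * b \<le> (\<Sum>q\<in>Q. 2 * card (E q))"
    using sum_mono[of Q "\<lambda>_. b" "\<lambda>q. 2 * card (E q)"] E by simp
  also have "\<dots> = 2 * card (\<Union>q\<in>Q. E q)"
  proof -
    have "card (\<Union>q\<in>Q. E q) = (\<Sum>q\<in>Q. card (E q))"
    proof (rule card_UN_disjoint[OF finQ])
      show "\<forall>q\<in>Q. finite (E q)" using cp(1) by (auto simp: E_def)
      show "\<forall>q\<in>Q. \<forall>r\<in>Q. q \<noteq> r \<longrightarrow> E q \<inter> E r = {}"
        using meet by (auto simp: E_def close_pairs_def)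
    qed
    then show ?thesis by (simp add: sum_distrib_left)
  qed
  also have "\<dots> \<le> 2 * card (close_pairs d G k)"
    using cp(1) by (intro mult_left_mono card_mono) (auto simp: E_def)
  finally show ?thesis using cp(2) by linarith
qed

section \<open>The point set\<close>

lemma dominating_minima_iff:
  "p \<in> dominating_minima S q \<longleftrightarrow>
    p \<in> S \<and> dominates p q \<and> (\<forall>p'\<in>S. dominates p' q \<longrightarrow> dominates p p' \<longrightarrow> p' = p)"
  unfolding dominating_minima_def minima_def by blast

text \<open>Here \<open>a\<close> is the upper left and \<open>b\<close> the lower right corner. A
  point of the query quadrant outside the box lies above \<open>a\<close> or to the right of
  \<open>b\<close>, so it dominates one of them and is not minimal. Going down from a point of
  \<open>G\<close> within the quadrant stays in the box, where the antichain property
  applies.\<close>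

lemma dominating_minima_box:
  assumes G: "G \<subseteq> S" "a \<in> G" "b \<in> G"
    and box: "\<And>p. p \<in> S \<Longrightarrow> fst a \<le> fst p \<Longrightarrow> fst p \<le> fst b \<Longrightarrow> snd b \<le> snd p \<Longrightarrow> snd p \<le> snd a \<Longrightarrow> p \<in> G"
    and inbox: "\<And>p. p \<in> G \<Longrightarrow> fst a \<le> fst p \<and> fst p \<le> fst b \<and> snd b \<le> snd p \<and> snd p \<le> snd a"
    and anti: "\<And>p p'. p \<in> G \<Longrightarrow> p' \<in> G \<Longrightarrow> dominates p p' \<Longrightarrow> p = p'"
  shows "dominating_minima S (fst a, snd b) = G"
proof (intro equalityI subsetI)
  fix p assume "p \<in> dominating_minima S (fst a, snd b)"
  then have p: "p \<in> S" "fst a \<le> fst p" "snd b \<le> snd p"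
    and min: "\<And>p'. p' \<in> S \<Longrightarrow> fst a \<le> fst p' \<Longrightarrow> snd b \<le> snd p' \<Longrightarrow> dominates p p' \<Longrightarrow> p' = p"
    unfolding dominating_minima_iff dominates_def fst_conv snd_conv by blast+
  show "p \<in> G"
  proof (rule ccontr)
    assume np: "p \<notin> G"
    have "a \<in> S" "b \<in> S" using G by auto
    then have "\<not> dominates p a" "\<not> dominates p b"
      using min[of a] min[of b] inbox[OF G(2)] inbox[OF G(3)] np G by auto
    then show False using box[OF p(1)] p np by (auto simp: dominates_def)
  qed
next
  fix p assume p: "p \<in> G"
  have "p' = p" if "p' \<in> S" "fst a \<le> fst p'" "snd b \<le> snd p'" "dominates p p'" for p'
  proof -
    have "p' \<in> G" using that inbox[OF p] by (intro box) (auto simp: dominates_def)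
    then show ?thesis using anti[OF p _ that(4)] by simp
  qed
  then show "p \<in> dominating_minima S (fst a, snd b)"
    using p G(1) inbox[OF p] unfolding dominating_minima_iff dominates_def fst_conv snd_conv by blast
qed

section \<open>Numerals in base b\<close>

definition num :: "nat \<Rightarrow> nat \<Rightarrow> (nat \<Rightarrow> nat) \<Rightarrow> nat" where
  "num b n f = (\<Sum>l<n. f l * b ^ l)"

lemma num_Suc: "num b (Suc n) f = num b n f + f n * b ^ n"
  by (simp add: num_def)

lemma num_less: "(\<And>l. l < n \<Longrightarrow> f l < b) \<Longrightarrow> num b n f < b ^ n"
proof (induction n)
  case (Suc n)
  then have "num b n f < b ^ n" "Suc (f n) \<le> b" by (auto simp: Suc_le_eq)
  then have "num b n f + f n * b ^ n < Suc (f n) * b ^ n" by simp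
  also have "\<dots> \<le> b * b ^ n" using \<open>Suc (f n) \<le> b\<close> by (intro mult_right_mono) auto
  finally show ?case by (simp add: num_Suc)
qed (simp add: num_def)

text \<open>The lower digits contribute less than \<open>b ^ n\<close>, too little to offset a
  smaller top digit.\<close>

lemma num_top_le:
  assumes "\<And>l. l < Suc n \<Longrightarrow> f l < b" "\<And>l. l < Suc n \<Longrightarrow> h l < b"
    and le: "num b (Suc n) f \<le> num b (Suc n) h"
  shows "f n \<le> h n"
proof (rule ccontr)
  assume "\<not> f n \<le> h n"
  then have "Suc (h n) * b ^ n \<le> f n * b ^ n" by (intro mult_right_mono) auto
  moreover have "num b n h < b ^ n" using num_less assms by auto
  ultimately show False using le by (simp add: num_Suc)
qed

text \<open>Induction strips digits from the top: \<open>num_top_le\<close> from both sides pins the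
  top digit of \<open>h\<close>, and the remaining parts are ordered as before.\<close>

lemma num_between:
  assumes "\<And>l. l < n \<Longrightarrow> f l < b" "\<And>l. l < n \<Longrightarrow> g l < b" "\<And>l. l < n \<Longrightarrow> h l < b"
    and "num b n f \<le> num b n h" "num b n h \<le> num b n g"
    and "\<And>l. i \<le> l \<Longrightarrow> l < n \<Longrightarrow> f l = g l" "i \<le> l" "l < n"
  shows "h l = f l"
  using assms
proof (induction n)
  case (Suc n)
  have "f n \<le> h n" using Suc.prems by (intro num_top_le[of n f b h]) auto
  moreover have "h n \<le> g n" using Suc.prems by (intro num_top_le[of n h b g]) auto
  moreover have fg: "f n = g n" using Suc.prems(6)[of n] Suc.prems(7,8) by auto
  ultimately have top: "h n = f n" by simp
  show ?case
  proof (cases "l = n")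
    case False
    then have "l < n" using Suc.prems by simp
    then show ?thesis using Suc.prems top fg by (intro Suc.IH) (auto simp: num_Suc)
  qed (use top in simp)
qed simp

text \<open>Digit 0 is the reference: varying one digit gives an arithmetic progression with step
  \<open>b ^ i\<close>.\<close>

lemma num_upd: 
  assumes "i < n"
  shows "num b n (f(i := j)) = num b n (f(i := 0)) + j * b ^ i"
proof -
  have "num b n (f(i := x)) = (\<Sum>l\<in>{..<n} - {i}. f l * b ^ l) + x * b ^ i" for x
    unfolding num_def using assms by (subst sum.remove[of _ i]) (auto intro!: sum.cong)
  then show ?thesis by simp
qed

section \<open>Digit points and digit groups\<close>

definition digit_rev :: "nat \<Rightarrow> (nat \<Rightarrow> nat) \<Rightarrow> nat \<Rightarrow> nat" where
  "digit_rev m f l = f (m - 1 - l)"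

lemma num_digit_rev_upd:
  assumes "i < m"
  shows "num b m (digit_rev m (f(i := j))) = num b m (digit_rev m (f(i := 0))) + j * b ^ (m - 1 - i)"
proof -
  have rev: "num b m (digit_rev m (f(i := x))) = num b m ((digit_rev m f)(m - 1 - i := x))" for x
    unfolding num_def using assms by (intro sum.cong) (auto simp: digit_rev_def)
  show ?thesis unfolding rev[of j] rev[of 0] by (rule num_upd) (use assms in simp)
qed

text \<open>The minus sign makes raising a digit move the point right and down, so points differing
  in one digit are incomparable.\<close>

definition digit_point :: "nat \<Rightarrow> nat \<Rightarrow> (nat \<Rightarrow> nat) \<Rightarrow> point" where
  "digit_point b m f = (real (num b m f), - real (num b m (digit_rev m f)))"

definition digit_funs :: "nat \<Rightarrow> nat \<Rightarrow> (nat \<Rightarrow> nat) set" where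
  "digit_funs b m = {..<m} \<rightarrow>\<^sub>E {..<b}"

lemma digit_funs_less: "f \<in> digit_funs b m \<Longrightarrow> l < m \<Longrightarrow> f l < b"
  by (auto simp: digit_funs_def)

lemma digit_funs_upd: "f \<in> digit_funs b m \<Longrightarrow> i < m \<Longrightarrow> j < b \<Longrightarrow> f(i := j) \<in> digit_funs b m"
  by (auto simp: digit_funs_def PiE_iff extensional_def)

text \<open>The first coordinate suffices: apply \<open>num_between\<close> with both bounds equal
  to \<open>f\<close>.\<close>

lemma inj_digit_point: "inj_on (digit_point b m) (digit_funs b m)"
proof (rule inj_onI)
  fix f g assume fg: "f \<in> digit_funs b m" "g \<in> digit_funs b m" "digit_point b m f = digit_point b m g"
  have "g l = f l" if "l < m" for l
    by (rule num_between[of m f b f g 0]) (use fg that digit_funs_less in \<open>auto simp: digit_point_def\<close>)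
  then show "f = g" using fg(1,2) unfolding digit_funs_def by (intro PiE_ext) auto
qed

definition digit_group :: "nat \<Rightarrow> nat \<Rightarrow> nat \<Rightarrow> (nat \<Rightarrow> nat) \<Rightarrow> point set" where
  "digit_group b m i f = (\<lambda>j. digit_point b m (f(i := j))) ` {..<b}"

text \<open>For a digit point in the box, the first coordinate fixes the digits above
  \<open>i\<close>. The second fixes those below \<open>i\<close>, since reversal makes them leading
  digits. Only digit \<open>i\<close> is free. The padding \<open>F\<close> lies below the
  box.\<close>

lemma dominating_minima_digit_group:
  assumes f: "f \<in> digit_funs b m" and i: "i < m" and b: "0 < b"
    and F: "\<And>p. p \<in> F \<Longrightarrow> snd p \<le> - real (b ^ m)"
  shows "dominating_minima (digit_point b m ` digit_funs b m \<union> F)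
    (fst (digit_point b m (f(i := 0))), snd (digit_point b m (f(i := b - 1)))) = digit_group b m i f"
proof (rule dominating_minima_box)
  have X: "fst (digit_point b m (f(i := j))) = fst (digit_point b m (f(i := 0))) + real (j * b ^ i)" for j
    using num_upd[OF i, of b f j] by (simp add: digit_point_def)
  have Y: "snd (digit_point b m (f(i := j))) = snd (digit_point b m (f(i := 0))) - real (j * b ^ (m - 1 - i))" for j
    using num_digit_rev_upd[OF i, of b f j] by (simp add: digit_point_def)
  show "digit_group b m i f \<subseteq> digit_point b m ` digit_funs b m \<union> F"
    using f i digit_funs_upd by (auto simp: digit_group_def)
  show "digit_point b m (f(i := 0)) \<in> digit_group b m i f"
    "digit_point b m (f(i := b - 1)) \<in> digit_group b m i f"
    using b by (auto simp: digit_group_def)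
  {
    fix p assume "p \<in> digit_group b m i f"
    then obtain j where j: "j < b" "p = digit_point b m (f(i := j))" by (auto simp: digit_group_def)
    then have "j * b ^ i \<le> (b - 1) * b ^ i" "j * b ^ (m - 1 - i) \<le> (b - 1) * b ^ (m - 1 - i)"
      by auto
    then have "real (j * b ^ i) \<le> real ((b - 1) * b ^ i)" 
      "real (j * b ^ (m - 1 - i)) \<le> real ((b - 1) * b ^ (m - 1 - i))"
      by (simp_all only: of_nat_le_iff)
    then show "fst (digit_point b m (f(i := 0))) \<le> fst p \<and>
      fst p \<le> fst (digit_point b m (f(i := b - 1))) \<and>
      snd (digit_point b m (f(i := b - 1))) \<le> snd p \<and> snd p \<le> snd (digit_point b m (f(i := 0)))"
      unfolding j(2) X[of j] X[of "b - 1"] Y[of j] Y[of "b - 1"] by simp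
  }
  {
    fix p p' assume "p \<in> digit_group b m i f" "p' \<in> digit_group b m i f" and dom: "dominates p p'"
    then obtain j j' where j: "p = digit_point b m (f(i := j))" "p' = digit_point b m (f(i := j'))"
      by (auto simp: digit_group_def)
    have "real (j' * b ^ i) \<le> real (j * b ^ i)" "real (j * b ^ (m - 1 - i)) \<le> real (j' * b ^ (m - 1 - i))"
      using dom unfolding dominates_def j X[of j] X[of j'] Y[of j] Y[of j'] by simp_all
    then have "j = j'" using b by simp
    then show "p = p'" using j by simp
  }
  {
    fix p assume p: "p \<in> digit_point b m ` digit_funs b m \<union> F"
      "fst (digit_point b m (f(i := 0))) \<le> fst p" "fst p \<le> fst (digit_point b m (f(i := b - 1)))"
      "snd (digit_point b m (f(i := b - 1))) \<le> snd p" "snd p \<le> snd (digit_point b m (f(i := 0)))"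
    have f0: "f(i := 0) \<in> digit_funs b m" and f1: "f(i := b - 1) \<in> digit_funs b m"
      using f i b digit_funs_upd by auto
    have rev: "digit_rev m g l < b" if "g \<in> digit_funs b m" "l < m" for g l
      using digit_funs_less[OF that(1), of "m - 1 - l"] that(2) by (simp add: digit_rev_def)
    have "num b m (digit_rev m (f(i := b - 1))) < b ^ m" using num_less rev[OF f1] by blast
    then have "- real (b ^ m) < snd (digit_point b m (f(i := b - 1)))"
      by (simp add: digit_point_def del: of_nat_power)
    then have "p \<notin> F" using F[of p] p(4) by auto
    then obtain h where h: "h \<in> digit_funs b m" "p = digit_point b m h" using p(1) by auto
    have high: "h l = f l" if "i < l" "l < m" for l
    proof -
      \<comment> \<open>The bounds agree from position \<open>Suc i\<close> upwards.\<close>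
      have "h l = (f(i := 0)) l"
        by (rule num_between[of m "f(i := 0)" b "f(i := b - 1)" h "Suc i"])
          (use p(2,3) h digit_funs_less[OF f0] digit_funs_less[OF f1] digit_funs_less[OF h(1)] that
            in \<open>auto simp: digit_point_def\<close>)
      then show ?thesis using that by simp
    qed
    have low: "h l = f l" if "l < i" for l
    proof -
      \<comment> \<open>After reversal the free digit is at \<open>m - 1 - i\<close>, and digits
        \<open>l < i\<close> occupy the positions from \<open>m - i\<close> on.\<close>
      have "digit_rev m h (m - 1 - l) = digit_rev m (f(i := 0)) (m - 1 - l)"
      proof (rule num_between[of m "digit_rev m (f(i := 0))" b "digit_rev m (f(i := b - 1))" "digit_rev m h" "m - i"])
        show "num b m (digit_rev m (f(i := 0))) \<le> num b m (digit_rev m h)"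
          "num b m (digit_rev m h) \<le> num b m (digit_rev m (f(i := b - 1)))"
          using p(4,5) h(2) by (auto simp: digit_point_def)
        show "digit_rev m (f(i := 0)) l = digit_rev m (f(i := b - 1)) l" if "m - i \<le> l" "l < m" for l
          using that i by (auto simp: digit_rev_def)
      qed (use rev[OF f0] rev[OF f1] rev[OF h(1)] that i in auto)
      then show ?thesis using that i by (auto simp: digit_rev_def)
    qed
    have "h = f(i := h i)"
    proof (rule PiE_ext[of _ "{..<m}" "\<lambda>_. {..<b}"])
      show "h \<in> {..<m} \<rightarrow>\<^sub>E {..<b}" "f(i := h i) \<in> {..<m} \<rightarrow>\<^sub>E {..<b}"
        using h(1) f i digit_funs_upd digit_funs_less unfolding digit_funs_def[symmetric] by auto
      show "h l = (f(i := h i)) l" if "l \<in> {..<m}" for l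
        using high[of l] low[of l] that by (cases l i rule: linorder_cases) auto
    qed
    then show "p \<in> digit_group b m i f"
      unfolding digit_group_def using h(2) digit_funs_less[OF h(1) i]
      by (intro image_eqI[of _ _ "h i"]) auto
  }
qed

text \<open>For given \<open>i\<close>, the value \<open>f i\<close> does not affect the group;
  normalising it to 0 removes this redundancy.\<close>

definition digit_lines :: "nat \<Rightarrow> nat \<Rightarrow> (nat \<times> (nat \<Rightarrow> nat)) set" where
  "digit_lines b m = (SIGMA i:{..<m}. {f \<in> digit_funs b m. f i = 0})"

text \<open>Fixing digit \<open>i\<close> leaves \<open>m - 1\<close> free digits; the factor
  \<open>b\<close> restores the exponent \<open>m\<close>.\<close>

lemma digit_lines_card:
  assumes "0 < b"
  shows "finite (digit_lines b m)" "card (digit_lines b m) * b = m * b ^ m"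
proof -
  have fin: "finite (digit_funs b m)" by (simp add: digit_funs_def finite_PiE)
  then show "finite (digit_lines b m)" by (auto simp: digit_lines_def)
  have "card {f \<in> digit_funs b m. f i = 0} = b ^ (m - 1)" if i: "i < m" for i
  proof -
    have "f \<in> digit_funs b m \<and> f i = 0 \<longleftrightarrow> f \<in> (\<Pi>\<^sub>E l\<in>{..<m}. if l = i then {0} else {..<b})" for f
      unfolding digit_funs_def PiE_iff using i assms by (metis empty_iff insert_iff lessThan_iff)
    then have "{f \<in> digit_funs b m. f i = 0} = (\<Pi>\<^sub>E l\<in>{..<m}. if l = i then {0} else {..<b})"
      by blast
    also have "card \<dots> = (\<Prod>l<m. if l = i then 1 else b)"
      by (simp add: card_PiE if_distrib cong: if_cong)
    also have "\<dots> = (\<Prod>l\<in>{..<m} - {i}. b)"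
      using i by (subst prod.remove[of _ i]) (auto intro!: prod.cong)
    finally show ?thesis using i by simp
  qed
  then have "card (digit_lines b m) = m * b ^ (m - 1)"
    using fin by (simp add: digit_lines_def)
  then show "card (digit_lines b m) * b = m * b ^ m" by (cases m) (auto simp: algebra_simps)
qed

lemma digit_group_card:
  assumes "f \<in> digit_funs b m" "i < m"
  shows "card (digit_group b m i f) = b"
proof -
  have "inj_on (\<lambda>j. digit_point b m (f(i := j))) {..<b}"
  proof (rule inj_onI)
    fix j k assume "j \<in> {..<b}" "k \<in> {..<b}" "digit_point b m (f(i := j)) = digit_point b m (f(i := k))"
    then have "f(i := j) = f(i := k)"
      using assms digit_funs_upd by (intro inj_onD[OF inj_digit_point]) auto
    then show "j = k" by (metis fun_upd_same)
  qed
  then show ?thesis by (simp add: digit_group_def card_image)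
qed

text \<open>Two distinct points of a group differ exactly in digit \<open>i\<close>, so a common
  pair determines \<open>i\<close>. The other digits, with \<open>f i = 0\<close>, then determine
  \<open>f\<close>.\<close>

lemma digit_groups_meet:
  assumes "(i, f) \<in> digit_lines b m" "(i', f') \<in> digit_lines b m" "(i, f) \<noteq> (i', f')"
    and e: "e \<subseteq> digit_group b m i f" "e \<subseteq> digit_group b m i' f'"
  shows "card e \<noteq> 2"
proof
  assume "card e = 2"
  then obtain p r where pr: "e = {p, r}" "p \<noteq> r" by (auto simp: card_2_iff)
  have f: "f \<in> digit_funs b m" "i < m" "f i = 0" "f' \<in> digit_funs b m" "i' < m" "f' i' = 0"
    using assms(1,2) by (auto simp: digit_lines_def)
  obtain j k j' k' where j: "j < b" "k < b" "j' < b" "k' < b"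
    and p: "p = digit_point b m (f(i := j))" "p = digit_point b m (f'(i' := j'))"
    and r: "r = digit_point b m (f(i := k))" "r = digit_point b m (f'(i' := k'))"
    using e pr(1) by (auto simp: digit_group_def)
  have 1: "f(i := j) = f'(i' := j')" "f(i := k) = f'(i' := k')"
    using p r f j by (auto intro!: inj_onD[OF inj_digit_point] digit_funs_upd)
  have "j \<noteq> k" using p r pr by auto
  then have ii: "i = i'" using 1 by (metis fun_upd_other fun_upd_same)
  have "f l = f' l" for l
    using fun_cong[OF 1(1), of l] ii f by (cases "l = i") auto
  then show False using ii assms(3) by auto
qed

section \<open>Choice of parameters\<close>

text \<open>With \<open>l = log 2 n\<close>, let \<open>m\<close> be
  \<open>l / (g * log 2 l)\<close> rounded down and \<open>b\<close> be
  \<open>n powr (1 / m)\<close> rounded down; before rounding, the base is at least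
  \<open>l powr g\<close>.\<close>

lemma base_and_length:
  fixes \<gamma> :: real
  assumes "\<gamma> > 0"
  shows "\<exists>c>0. \<forall>\<^sub>F n in sequentially. \<exists>b m. 4 \<le> b \<and> b ^ m \<le> n \<and> real n \<le> 3 * real (b ^ m) \<and>
    log 2 (real n) powr \<gamma> \<le> real b \<and> c * (log 2 (real n) / log 2 (log 2 (real n))) \<le> real m"
proof -
  \<comment> \<open>The exponent exceeds both \<gamma> and 1: after rounding, \<open>b\<close> still
    bounds \<open>l powr \<gamma>\<close>, and also \<open>l\<close> and hence \<open>m\<close>,
    even for small \<gamma>.\<close>
  define g where "g = \<gamma> + 1"
  have g: "g > 1" using assms by (simp add: g_def)
  have lim: "filterlim (\<lambda>n::nat. log 2 (real n)) at_top sequentially" by real_asymp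
  have "\<forall>\<^sub>F l::real in at_top. l powr \<gamma> + 1 \<le> l powr g"
    unfolding g_def using assms by real_asymp
  moreover have "\<forall>\<^sub>F l::real in at_top. 5 \<le> l powr g" using g by real_asymp
  moreover have "\<forall>\<^sub>F l::real in at_top. l + 1 \<le> l powr g" using g by real_asymp
  moreover have "\<forall>\<^sub>F l::real in at_top. g * log 2 l \<ge> 1" using g by real_asymp
  moreover have "\<forall>\<^sub>F l::real in at_top. 2 \<le> l / (g * log 2 l)" using g by real_asymp
  ultimately have "\<forall>\<^sub>F l::real in at_top. l > 1 \<and> l powr \<gamma> + 1 \<le> l powr g \<and> 5 \<le> l powr g \<and>
      l + 1 \<le> l powr g \<and> g * log 2 l \<ge> 1 \<and> 2 \<le> l / (g * log 2 l)"
    using eventually_gt_at_top[of "1::real"] by eventually_elim auto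
  then have ev: "\<forall>\<^sub>F n in sequentially. log 2 (real n) > 1 \<and>
      log 2 (real n) powr \<gamma> + 1 \<le> log 2 (real n) powr g \<and> 5 \<le> log 2 (real n) powr g \<and>
      log 2 (real n) + 1 \<le> log 2 (real n) powr g \<and> g * log 2 (log 2 (real n)) \<ge> 1 \<and>
      2 \<le> log 2 (real n) / (g * log 2 (log 2 (real n)))"
    using lim by (auto simp: filterlim_iff)
  show ?thesis
  proof (intro exI[of _ "1 / (2 * g)"] conjI)
    show "1 / (2 * g) > 0" using g by simp
    show "\<forall>\<^sub>F n in sequentially. \<exists>b m. 4 \<le> b \<and> b ^ m \<le> n \<and> real n \<le> 3 * real (b ^ m) \<and>
      log 2 (real n) powr \<gamma> \<le> real b \<and> 1 / (2 * g) * (log 2 (real n) / log 2 (log 2 (real n))) \<le> real m"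
      using ev eventually_gt_at_top[of "0::nat"]
    proof eventually_elim
      case (elim n)
      define l where "l = log 2 (real n)"
      define x where "x = l / (g * log 2 l)"
      define m where "m = nat \<lfloor>x\<rfloor>"
      define r where "r = real n powr (1 / real m)"
      define b where "b = nat \<lfloor>r\<rfloor>"
      have l: "l > 1" "l powr \<gamma> + 1 \<le> l powr g" "5 \<le> l powr g" "l + 1 \<le> l powr g"
        "g * log 2 l \<ge> 1" "x \<ge> 2" and n: "n > 0"
        using elim by (auto simp: l_def x_def)
      have m: "real m \<le> x" "x - 1 < real m" using l(6) unfolding m_def by linarith+
      have m0: "m > 0" using m l(6) by simp
      have "x \<le> l" using l unfolding x_def by (simp add: divide_le_eq mult_le_cancel_left1)
      have r: "r = 2 powr (l / real m)"
        unfolding r_def l_def using n by (subst powr_log_cancel[of 2 "real n", symmetric]) (auto simp: powr_powr simp del: powr_log_cancel)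
      have "l powr g = 2 powr (g * log 2 l)"
        using l(1) by (subst powr_log_cancel[of 2 l, symmetric]) (auto simp: powr_powr mult.commute simp del: powr_log_cancel)
      also have "g * log 2 l = l / x" using l unfolding x_def by simp
      also have "2 powr (l / x) \<le> r"
        unfolding r using m m0 l by (intro powr_mono divide_left_mono) auto
      finally have rg: "l powr g \<le> r" .
      then have b: "real b \<le> r" "r < real b + 1" "r \<ge> 5" using l(3) unfolding b_def by linarith+
      have rm: "r ^ m = real n"
        unfolding r_def using n m0 by (simp add: powr_realpow[symmetric] powr_powr)
      have "b \<ge> 4" using b by linarith
      moreover have "b ^ m \<le> n"
      proof -
        have "real b ^ m \<le> r ^ m" using b by (intro power_mono) auto
        then show ?thesis using rm by (metis of_nat_le_iff of_nat_power)
      qed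
      \<comment> \<open>Rounding \<open>r\<close> down to \<open>b\<close> costs a factor of at most
        \<open>(1 + 1 / b) ^ m \<le> exp (m / b) \<le> exp 1\<close>, because
        \<open>m \<le> l \<le> b\<close>.\<close>
      moreover have "real n \<le> 3 * real (b ^ m)"
      proof -
        have "(1 + 1 / real b) ^ m \<le> exp (1 / real b) ^ m"
          by (intro power_mono) (auto simp: exp_ge_add_one_self)
        also have "\<dots> = exp (real m / real b)" by (simp add: exp_of_nat_mult[symmetric])
        also have "\<dots> \<le> exp 1"
          using m \<open>x \<le> l\<close> b rg l \<open>b \<ge> 4\<close> by simp
        also have "\<dots> \<le> 3" by (rule exp_le)
        finally have e: "(1 + 1 / real b) ^ m \<le> 3" .
        have "real n \<le> (real b + 1) ^ m" unfolding rm[symmetric] using b by (intro power_mono) auto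
        also have "\<dots> = (1 + 1 / real b) ^ m * real b ^ m"
          using \<open>b \<ge> 4\<close> by (simp add: power_mult_distrib[symmetric] field_simps)
        also have "\<dots> \<le> 3 * real b ^ m" using e by (rule mult_right_mono) simp
        finally show ?thesis by simp
      qed
      moreover have "l powr \<gamma> \<le> real b" using rg b l by linarith
      \<comment> \<open>Since \<open>x \<ge> 2\<close>, rounding \<open>x\<close> down loses at most
        half of it; hence the 2.\<close>
      moreover have "1 / (2 * g) * (l / log 2 l) \<le> real m"
      proof -
        have "1 / (2 * g) * (l / log 2 l) = x / 2" by (simp add: x_def)
        also have "\<dots> \<le> real m" using m l(6) by linarith
        finally show ?thesis .
      qed
      ultimately show ?case unfolding l_def by blast
    qed
  qed
qed

section \<open>Assembly of the lower bound\<close>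

theorem theorem3:
  fixes \<gamma> :: real
    and d :: nat
    and D :: "point set \<Rightarrow> pm_structure"
  assumes "\<gamma> > 0"
    and "\<And>S. finite S \<Longrightarrow> well_formed d (D S)"
    and "\<And>S. finite S \<Longrightarrow> answers_dominating_minima d (D S) S"
    and "\<exists>C. \<forall>\<^sub>F n in sequentially. \<forall>S q. finite S \<and> card S = n \<longrightarrow>
           real (query_time (D S) q)
             \<le> C * (log 2 (real n) powr \<gamma> + real (card (dominating_minima S q)))"
  shows "\<exists>c>0. \<forall>\<^sub>F n in sequentially. \<exists>S. finite S \<and> card S = n \<and>
           real (pm_space (D S)) \<ge> c * (real n * (log 2 (real n) / log 2 (log 2 (real n))))"
proof -
  obtain C where C: "\<forall>\<^sub>F n in sequentially. \<forall>S q. finite S \<and> card S = n \<longrightarrow>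
           real (query_time (D S) q)
             \<le> C * (log 2 (real n) powr \<gamma> + real (card (dominating_minima S q)))"
    using assms(4) by blast
  obtain c where c: "c > 0" and params: "\<forall>\<^sub>F n in sequentially. \<exists>b m. 4 \<le> b \<and> b ^ m \<le> n \<and>
    real n \<le> 3 * real (b ^ m) \<and> log 2 (real n) powr \<gamma> \<le> real b \<and>
    c * (log 2 (real n) / log 2 (log 2 (real n))) \<le> real m"
    using base_and_length[OF assms(1)] by blast
  \<comment> \<open>\<open>C\<close> may be negative, while the estimates multiply by a nonnegative
    constant.\<close>
  define C' where "C' = max C 0"
  \<comment> \<open>As \<open>log 2 n powr \<gamma> \<le> b\<close>, a query with \<open>b\<close>
    answers takes at most \<open>2 * C' * b\<close> instructions, and one more is at most
    \<open>(2 * C' + 1) * b\<close>. The 4 is the one in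
    \<open>pointer_machine_space_bound\<close>.\<close>
  define k where "k = nat \<lceil>4 * (2 * C' + 1)\<rceil>"
  have k: "4 * (2 * C' + 1) \<le> real (Suc k)" unfolding k_def by linarith
  define M :: nat where "M = 2 ^ ((d + 1) ^ Suc k)"
  have M: "M > 0" by (simp add: M_def)
  show ?thesis
  \<comment> \<open>The 6 combines the 2 of the space bound with the 3 of
    \<open>n \<le> 3 * b ^ m\<close>.\<close>
  proof (intro exI[of _ "c / (6 * real M)"] conjI)
    show "c / (6 * real M) > 0" using c M by simp
    show "\<forall>\<^sub>F n in sequentially. \<exists>S. finite S \<and> card S = n \<and>
      real (pm_space (D S)) \<ge> c / (6 * real M) * (real n * (log 2 (real n) / log 2 (log 2 (real n))))"
      using C params
    proof eventually_elim
      case (elim n)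
      then obtain b m where bm: "4 \<le> b" "b ^ m \<le> n" "real n \<le> 3 * real (b ^ m)"
        "log 2 (real n) powr \<gamma> \<le> real b" "c * (log 2 (real n) / log 2 (log 2 (real n))) \<le> real m"
        by blast
      define P where "P = digit_point b m ` digit_funs b m"
      \<comment> \<open>Padding to exactly \<open>n\<close> points; all of it lies below the digit
        points, whose second coordinates exceed \<open>- (b ^ m)\<close>.\<close>
      define F :: "point set" where "F = (\<lambda>i. (0, - real (b ^ m + i))) ` {..<n - b ^ m}"
      define S where "S = P \<union> F"
      have b0: "0 < b" using bm by simp
      have P: "finite P" "card P = b ^ m"
        unfolding P_def card_image[OF inj_digit_point]
        by (simp_all add: digit_funs_def finite_PiE card_PiE)
      have F: "finite F" "card F = n - b ^ m"
        unfolding F_def by (simp, subst card_image) (auto simp: inj_on_def)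
      have low: "snd p \<le> - real (b ^ m)" if "p \<in> F" for p using that by (auto simp: F_def)
      have "- real (b ^ m) < snd p" if "p \<in> P" for p
      proof -
        obtain f where f: "f \<in> digit_funs b m" "p = digit_point b m f" using \<open>p \<in> P\<close> by (auto simp: P_def)
        have "num b m (digit_rev m f) < b ^ m"
          using digit_funs_less[OF f(1)] by (intro num_less) (auto simp: digit_rev_def)
        then show ?thesis using f(2) by (simp add: digit_point_def del: of_nat_power)
      qed
      then have "P \<inter> F = {}" using low by fastforce
      then have S: "finite S" "card S = n"
        using P F bm(2) by (simp_all add: S_def card_Un_disjoint)
      have "card (digit_lines b m) * b \<le> 2 * (card (nodes (D S)) * 2 ^ ((d + 1) ^ Suc k))"
      proof (rule pointer_machine_space_bound[where A = "\<lambda>(i, f). digit_group b m i f"])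
        show "well_formed d (D S)" using assms(2) S by blast
        show "finite (digit_lines b m)" using digit_lines_card[OF b0] by blast
        show "4 \<le> b" using bm by simp
      next
        fix q assume "q \<in> digit_lines b m"
        then obtain i f where q: "q = (i, f)" "i < m" "f \<in> digit_funs b m" by (auto simp: digit_lines_def)
        show card: "card (case q of (i, f) \<Rightarrow> digit_group b m i f) = b"
          using digit_group_card q by simp
        obtain x where x: "dominating_minima S x = digit_group b m i f"
          using dominating_minima_digit_group[OF q(3,2) b0 low] unfolding S_def P_def by blast
        obtain c where c: "run d (query_alg (D S) x) (init (D S)) = Some c"
          "reported c = digit_group b m i f"
          using assms(3)[OF S(1)] x unfolding answers_dominating_minima_def by metis
        have "real (length (query_alg (D S) x)) \<le> C * (log 2 (real n) powr \<gamma> + real b)"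
          using elim(1) S x card q(1) unfolding query_time_def by (metis case_prod_conv)
        also have "\<dots> \<le> C' * (log 2 (real n) powr \<gamma> + real b)"
          by (intro mult_right_mono) (auto simp: C'_def)
        also have "\<dots> \<le> C' * (2 * real b)"
          using bm(4) by (intro mult_left_mono) (auto simp: C'_def)
        finally have "real (length (query_alg (D S) x)) + 1 \<le> (2 * C' + 1) * real b"
          using bm(1) by (simp add: algebra_simps)
        then have "(real (length (query_alg (D S) x)) + 1) * 4 \<le> 4 * (2 * C' + 1) * real b"
          by (simp add: algebra_simps)
        also have "\<dots> \<le> real (Suc k) * real b" using k by (intro mult_right_mono) auto
        finally have "real (Suc (length (query_alg (D S) x)) * 4) \<le> real (Suc k * b)"
          by (simp add: algebra_simps)
        then have "Suc (length (query_alg (D S) x)) * 4 \<le> Suc k * b" by (simp only: of_nat_le_iff)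
        then show "\<exists>as c. run d as (init (D S)) = Some c \<and>
          reported c = (case q of (i, f) \<Rightarrow> digit_group b m i f) \<and> Suc (length as) * 4 \<le> Suc k * b"
          using c q(1) by auto
      next
        fix q r e assume "q \<in> digit_lines b m" "r \<in> digit_lines b m" "q \<noteq> r"
          "e \<subseteq> (case q of (i, f) \<Rightarrow> digit_group b m i f)" "e \<subseteq> (case r of (i, f) \<Rightarrow> digit_group b m i f)"
        then show "card e \<noteq> 2"
          by (cases q, cases r) (simp only: case_prod_conv, rule digit_groups_meet)
      qed
      then have "m * b ^ m \<le> 2 * (pm_space (D S) * M)"
        by (simp only: digit_lines_card(2)[OF b0] pm_space_def M_def)
      then have "real (m * b ^ m) \<le> real (2 * (pm_space (D S) * M))" by (simp only: of_nat_le_iff)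
      then have space: "real m * real (b ^ m) \<le> 2 * real M * real (pm_space (D S))"
        by (simp add: algebra_simps)
      define z where "z = log 2 (real n) / log 2 (log 2 (real n))"
      have "c * z * real n \<le> real m * (3 * real (b ^ m))"
        using bm(3,5) unfolding z_def by (intro mult_mono) auto
      also have "\<dots> \<le> 6 * real M * real (pm_space (D S))" using space by simp
      finally have "c / (6 * real M) * (real n * z) \<le> real (pm_space (D S))"
        using M by (simp add: field_simps)
      then show ?case unfolding z_def using S by blast
    qed
  qed
qed

end
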